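(* Let $\mathcal{A}$ be a complex Banach algebra with identity $1$ and let $a\in\mathcal{A}$. The following statements are equivalent. (1) $a\in\mathcal{A}^{ad}$. (2) There exists an idempotent $p\in\{a\}''$ such that $a+p$ is invertible in $\mathcal{A}$ and $ap\in\mathcal{A}^{acc}$. (3) There exists an idempotent $p\in\{a\}'$ such that $a+p$ is invertible in $\mathcal{A}$ and $ap\in\mathcal{A}^{acc}$. Moreover, in case (2), the element $b=(a+p)^{-1}(1-p)$ is an ag-Drazin inverse of $a$.
   Context: For a complex Banach algebra $\mathcal{A}$ with identity $1$ and $a\in\mathcal{A}$: $\sigma(a)$ is the spectrum of $a$; $\{a\}'=\{b\in\mathcal{A}: ab=ba\}$ is the commutant and $\{a\}''$ the double commutant (the set of elements commuting with every element of $\{a\}'$); $\mathcal{A}^{qnil}=\{a\in\mathcal{A}:\sigma(a)=\{0\}\}$. An element $a$ is generalized Drazin invertible if there exists $x\in\{a\}'$ with $xax=x$ and $a-a^2x\in\mathcal{A}^{qnil}$; $\mathcal{A}^{d}$ is the set of all such elements. Define $\mathcal{A}^{acc}=\{a\in\mathcal{A}: a-\lambda 1\in\mathcal{A}^{d}\text{ for all }\lambda\in\mathbb{C}\setminus\{0\}\}$. An element $a$ is ag-Drazin invertible if there exists $x\in\{a\}'$ with $xax=x$ and $a-a^2x\in\mathcal{A}^{acc}$; any such $x$ is called an ag-Drazin inverse of $a$, and $\mathcal{A}^{ad}$ is the set of all ag-Drazin invertible elements. *)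

theory Defs
  imports "HOL-Analysis.Analysis"
begin

text \<open>
  The library only has real normed algebras, so the complex scalar multiplication is added on top
  of the real structure and required to extend it.  Neither commutativity nor \<open>norm 1 = 1\<close> is
  assumed; \<open>real_algebra_1\<close> includes \<open>0 \<noteq> 1\<close>.
\<close>

class complex_banach_algebra_1 = real_normed_algebra + real_algebra_1 + banach +
  fixes scaleC :: "complex \<Rightarrow> 'a \<Rightarrow> 'a"  (infixr \<open>*\<^sub>C\<close> 75)
  assumes scaleR_scaleC: "scaleR r x = complex_of_real r *\<^sub>C x"
    and scaleC_add_right: "z *\<^sub>C (x + y) = z *\<^sub>C x + z *\<^sub>C y"
    and scaleC_add_left: "(z + w) *\<^sub>C x = z *\<^sub>C x + w *\<^sub>C x"
    and scaleC_scaleC: "z *\<^sub>C w *\<^sub>C x = (z * w) *\<^sub>C x"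
    and scaleC_one: "1 *\<^sub>C x = x"
    and mult_scaleC_left: "(z *\<^sub>C x) * y = z *\<^sub>C (x * y)"
    and mult_scaleC_right: "x * (z *\<^sub>C y) = z *\<^sub>C (x * y)"
    and norm_scaleC: "norm (z *\<^sub>C x) = cmod z * norm x"

instantiation complex :: complex_banach_algebra_1
begin

definition scaleC_complex :: "complex \<Rightarrow> complex \<Rightarrow> complex" where
  "scaleC_complex z x = z * x"

instance
  by standard (simp_all add: scaleC_complex_def scaleR_conv_of_real algebra_simps norm_mult)

end

definition alg_invertible :: "'a::monoid_mult \<Rightarrow> bool" where
  "alg_invertible a \<longleftrightarrow> (\<exists>b. a * b = 1 \<and> b * a = 1)"

text \<open>Meaningful only for invertible arguments, where the two-sided inverse is unique.\<close>

definition alg_inverse :: "'a::monoid_mult \<Rightarrow> 'a" where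
  "alg_inverse a = (THE b. a * b = 1 \<and> b * a = 1)"

definition idempotent_elem :: "'a::times \<Rightarrow> bool" where
  "idempotent_elem p \<longleftrightarrow> p * p = p"

definition alg_spectrum :: "'a::complex_banach_algebra_1 \<Rightarrow> complex set" where
  "alg_spectrum a = {z. \<not> alg_invertible (a - z *\<^sub>C 1)}"

definition commutant :: "'a::times set \<Rightarrow> 'a set" where
  "commutant S = {b. \<forall>s\<in>S. s * b = b * s}"

abbreviation double_commutant :: "'a::times set \<Rightarrow> 'a set" where
  "double_commutant S \<equiv> commutant (commutant S)"

definition quasinilpotents :: "'a::complex_banach_algebra_1 set" where
  "quasinilpotents = {a. alg_spectrum a = {0}}"

definition gen_drazin_invertibles :: "'a::complex_banach_algebra_1 set" where
  "gen_drazin_invertibles =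
    {a. \<exists>x \<in> commutant {a}. x * a * x = x \<and> a - a\<^sup>2 * x \<in> quasinilpotents}"

definition acc_elems :: "'a::complex_banach_algebra_1 set" where
  "acc_elems = {a. \<forall>z. z \<noteq> 0 \<longrightarrow> a - z *\<^sub>C 1 \<in> gen_drazin_invertibles}"

definition is_ag_drazin_inverse :: "'a::complex_banach_algebra_1 \<Rightarrow> 'a \<Rightarrow> bool" where
  "is_ag_drazin_inverse a x \<longleftrightarrow>
    x \<in> commutant {a} \<and> x * a * x = x \<and> a - a\<^sup>2 * x \<in> acc_elems"

definition ag_drazin_invertibles :: "'a::complex_banach_algebra_1 set" where
  "ag_drazin_invertibles = {a. \<exists>x. is_ag_drazin_inverse a x}"

end

theory Submission
  imports Defs
begin

text \<open>
  Generalized Drazin invertibility of \<open>a - z *\<^sub>C 1\<close> means that \<open>z\<close> is not an accumulation point of the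
  spectrum of \<open>a\<close> (\<open>gen_drazin_invertible_iff\<close>), so \<open>acc_elems\<close> consists of the elements whose spectrum
  accumulates at most at 0 (\<open>acc_elems_iff\<close>).

  If \<open>x\<close> is an ag-Drazin inverse of \<open>a\<close>, then \<open>a\<close> is invertible in the corner of the idempotent
  \<open>a * x\<close>, while its part in the other corner has a spectrum that accumulates at most at 0.  So some
  punctured disc around 0 contains no accumulation point of the spectrum of \<open>a\<close>
  (\<open>ag_drazin_isolated_near_zero\<close>).  Inside it, arbitrarily small circles around 0 miss the spectrum
  (\<open>circle_avoiding_discrete_set\<close>).  The Riesz idempotent \<open>p\<close> of a disc of radius less than 1 bounded by
  such a circle lies in the double commutant.  The spectrum of \<open>a * p\<close> lies in that disc, so it misses
  \<open>-1\<close> and accumulates at most at 0; hence \<open>a * p\<close> is in \<open>acc_elems\<close>, and \<open>a + p\<close> is invertible in the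
  corner of \<open>p\<close>, where it acts as \<open>a * p + 1\<close>.  In the corner of \<open>1 - p\<close> it is \<open>a\<close>, which is invertible
  there (\<open>ag_drazin_spectral_idempotent\<close>).  Conversely, an idempotent in the commutant with these
  properties yields an ag-Drazin inverse by a direct computation (\<open>ag_drazin_inverse_of_idempotent\<close>).

  The analytic content is the Riesz idempotent (\<open>riesz_idempotent_unit_circle\<close>), constructed by
  repeated squaring in place of a contour integral: if the unit circle misses the spectrum of \<open>w\<close>, then
  \<open>p\<close> is the limit of \<open>(1 - w ^ (2 ^ k))\<^sup>-\<^sup>1\<close>.  Convergence comes from a Lipschitz estimate that
  improves by the factor \<open>sqrt 2\<close> with every squaring (\<open>dyadic_resolvent_lipschitz\<close>).  The same limit
  shows that some power of \<open>w * p\<close> has norm below 1, which localises its spectrum without recourse to the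
  spectral radius formula.
\<close>

section \<open>Complex scalars\<close>

lemma scaleC_zero_left [simp]: "0 *\<^sub>C x = (0::'a::complex_banach_algebra_1)"
  using scaleC_add_left[of 0 0 x] by simp

lemma scaleC_zero_right [simp]: "z *\<^sub>C 0 = (0::'a::complex_banach_algebra_1)"
  using scaleC_add_right[of z 0 0] by simp

lemma scaleC_minus_left: "(- z) *\<^sub>C x = - (z *\<^sub>C (x::'a::complex_banach_algebra_1))"
  using scaleC_add_left[of z "- z" x] by (simp add: eq_neg_iff_add_eq_0 add.commute)

lemma scaleC_minus_right: "z *\<^sub>C (- x) = - (z *\<^sub>C (x::'a::complex_banach_algebra_1))"
  using scaleC_add_right[of z x "- x"] by (simp add: eq_neg_iff_add_eq_0 add.commute)

lemma scaleC_diff_left: "(z - w) *\<^sub>C x = z *\<^sub>C x - w *\<^sub>C (x::'a::complex_banach_algebra_1)"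
  using scaleC_add_left[of z "- w" x] by (simp add: scaleC_minus_left)

lemma scaleC_diff_right: "z *\<^sub>C (x - y) = z *\<^sub>C x - z *\<^sub>C (y::'a::complex_banach_algebra_1)"
  using scaleC_add_right[of z x "- y"] by (simp add: scaleC_minus_right)

lemmas scaleC_simps = scaleC_add_left scaleC_add_right scaleC_diff_left scaleC_diff_right
  scaleC_minus_left scaleC_minus_right scaleC_scaleC scaleC_one mult_scaleC_left mult_scaleC_right

lemma scaleC_power: "(z *\<^sub>C x) ^ n = z ^ n *\<^sub>C (x::'a::complex_banach_algebra_1) ^ n"
  by (induction n) (simp_all add: scaleC_simps mult_ac)

section \<open>Inverses in rings and monoids\<close>

lemma commute_mult:
  fixes a :: "'a::semigroup_mult"
  shows "a * x = x * a \<Longrightarrow> a * y = y * a \<Longrightarrow> a * (x * y) = (x * y) * a"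
  by (metis mult.assoc)

lemma alg_inverse_unique:
  fixes a :: "'a::monoid_mult"
  assumes "a * b = 1" "b * a = 1"
  shows "alg_inverse a = b"
  unfolding alg_inverse_def
proof (rule the_equality)
  show "a * b = 1 \<and> b * a = 1" using assms by simp
  fix c assume "a * c = 1 \<and> c * a = 1"
  then show "c = b" by (metis assms(1) mult.assoc mult_1_left mult_1_right)
qed

lemma alg_inverse:
  fixes a :: "'a::monoid_mult"
  assumes "alg_invertible a"
  shows "a * alg_inverse a = 1" "alg_inverse a * a = 1"
  using assms alg_inverse_unique unfolding alg_invertible_def by metis+

lemma alg_inverse_cancel:
  fixes a :: "'a::monoid_mult"
  assumes "alg_invertible a"
  shows "a * (alg_inverse a * x) = x" "alg_inverse a * (a * x) = x"
  using alg_inverse[OF assms] by (simp_all flip: mult.assoc)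

lemma alg_inverse_commute:
  fixes a :: "'a::monoid_mult"
  assumes "alg_invertible a" "a * y = y * a"
  shows "alg_inverse a * y = y * alg_inverse a"
proof -
  have "alg_inverse a * y = alg_inverse a * (y * a) * alg_inverse a"
    by (simp add: mult.assoc alg_inverse(1)[OF assms(1)])
  also have "\<dots> = y * alg_inverse a"
    unfolding assms(2)[symmetric] by (simp add: alg_inverse_cancel assms(1) mult.assoc)
  finally show ?thesis .
qed

lemma alg_invertible_commuting_factor:
  fixes a :: "'a::monoid_mult"
  assumes "alg_invertible (a * b)" "a * b = b * a"
  shows "alg_invertible a"
proof -
  let ?k = "alg_inverse (a * b)"
  have 1: "a * (b * ?k) = 1" using alg_inverse(1)[OF assms(1)] by (simp add: mult.assoc)
  have 2: "?k * b * a = 1" using alg_inverse(2)[OF assms(1)] assms(2) by (simp add: mult.assoc)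
  have "b * ?k = ?k * b"
    by (metis 1 2 mult.assoc mult_1_left mult_1_right)
  then show ?thesis unfolding alg_invertible_def using 1 2 by metis
qed

lemma alg_invertible_mult:
  fixes a :: "'a::monoid_mult"
  assumes "alg_invertible a" "alg_invertible b"
  shows "alg_invertible (a * b)" "alg_inverse (a * b) = alg_inverse b * alg_inverse a"
proof -
  let ?c = "alg_inverse b * alg_inverse a"
  have 1: "(a * b) * ?c = 1" "?c * (a * b) = 1"
    using assms by (simp_all add: mult.assoc alg_inverse_cancel alg_inverse)
  then show "alg_invertible (a * b)" "alg_inverse (a * b) = ?c"
    unfolding alg_invertible_def using alg_inverse_unique by blast+
qed

lemma alg_invertible_scaleC_iff:
  fixes a :: "'a::complex_banach_algebra_1"
  assumes "z \<noteq> 0"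
  shows "alg_invertible (z *\<^sub>C a) \<longleftrightarrow> alg_invertible a"
proof -
  have *: "alg_invertible (y *\<^sub>C b)" if "alg_invertible b" "y \<noteq> 0" for y and b :: 'a
    unfolding alg_invertible_def using that
    by (intro exI[of _ "inverse y *\<^sub>C alg_inverse b"]) (simp add: scaleC_simps alg_inverse)
  show ?thesis using *[of a z] *[of "z *\<^sub>C a" "inverse z"] assms by (auto simp: scaleC_simps)
qed

text \<open>
  Each of the two pairs of equations says that \<open>u\<close> is invertible in one corner of the
  decomposition of the identity into \<open>p\<close> and \<open>1 - p\<close>; the two corner inverses add up to an inverse.
\<close>

lemma alg_invertible_split:
  fixes u :: "'a::ring_1"
  assumes "u * c = p" "c * u = p" "u * d = 1 - p" "d * u = 1 - p"
  shows "alg_invertible u"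
  unfolding alg_invertible_def
  by (intro exI[of _ "c + d"]) (simp add: assms distrib_left distrib_right)

section \<open>The Neumann series and the resolvent\<close>

text \<open>
  The norm of the inverse is read off from \<open>s = 1 + x * s\<close>; the factor \<open>norm 1\<close> is present because
  the norm of the identity may differ from 1.
\<close>

lemma neumann_inverse:
  fixes x :: "'a::complex_banach_algebra_1"
  assumes "norm x < 1"
  shows "alg_invertible (1 - x)"
    and "norm (alg_inverse (1 - x)) \<le> norm (1::'a) / (1 - norm x)"
proof -
  have bound: "norm (x ^ n) \<le> norm (1::'a) * norm x ^ n" for n
  proof (induction n)
    case (Suc n)
    have "norm (x ^ Suc n) \<le> norm x * norm (x ^ n)" by (simp add: norm_mult_ineq)
    also have "\<dots> \<le> norm x * (norm (1::'a) * norm x ^ n)" by (intro mult_left_mono Suc) simp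
    finally show ?case by (simp add: mult_ac)
  qed simp
  have summ: "summable (\<lambda>n. x ^ n)"
    by (rule summable_comparison_test'[where N = 0, OF _ bound])
       (intro summable_mult summable_geometric, use assms in simp)
  define s where "s = (\<Sum>n. x ^ n)"
  have "s = x ^ 0 + (\<Sum>n. x ^ Suc n)" unfolding s_def using suminf_split_head[OF summ] by simp
  moreover have "(\<Sum>n. x ^ Suc n) = x * s" unfolding s_def using suminf_mult[OF summ, of x] by simp
  moreover have "(\<Sum>n. x ^ Suc n) = s * x"
    unfolding s_def using suminf_mult2[OF summ, of x] by (simp add: power_commutes)
  ultimately have s: "s = 1 + x * s" "s = 1 + s * x" by simp_all
  then have inv: "(1 - x) * s = 1" "s * (1 - x) = 1"
    by (simp_all add: left_diff_distrib right_diff_distrib diff_eq_eq)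
  show "alg_invertible (1 - x)" unfolding alg_invertible_def using inv by blast
  have "norm s \<le> norm (1::'a) + norm (x * s)" by (subst s(1)) (rule norm_triangle_ineq)
  also have "\<dots> \<le> norm (1::'a) + norm x * norm s" by (simp add: norm_mult_ineq)
  finally have "norm s \<le> norm (1::'a) / (1 - norm x)"
    using assms by (simp add: field_simps)
  then show "norm (alg_inverse (1 - x)) \<le> norm (1::'a) / (1 - norm x)"
    using alg_inverse_unique[OF inv] by simp
qed

text \<open>
  The resolvent identity in multiplicative form.
\<close>

lemma alg_inverse_diff:
  fixes a b :: "'a::ring_1"
  assumes "alg_invertible a" "alg_invertible b"
  shows "alg_inverse a - alg_inverse b = alg_inverse a * (b - a) * alg_inverse b"
  using assms
  by (simp add: algebra_simps alg_inverse_cancel alg_inverse)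

text \<open>
  Near an invertible \<open>1 - s *\<^sub>C w\<close>, the element \<open>1 - t *\<^sub>C w\<close> is the product of it with a small
  perturbation of the identity, so the Neumann series bounds the inverse locally; compactness makes
  the bound uniform.
\<close>

lemma resolvent_bounded_on_compact:
  fixes w :: "'a::complex_banach_algebra_1"
  assumes "compact K" and inv: "\<And>s. s \<in> K \<Longrightarrow> alg_invertible (1 - s *\<^sub>C w)"
  obtains M where "M \<ge> 0" "\<And>s. s \<in> K \<Longrightarrow> norm (alg_inverse (1 - s *\<^sub>C w)) \<le> M"
proof -
  define R where "R s = alg_inverse (1 - s *\<^sub>C w)" for s
  have loc: "\<exists>e>0. \<exists>M. \<forall>t\<in>K \<inter> ball s e. norm (R t) \<le> M" if s: "s \<in> K" for s
  proof -
    define B where "B = norm (w * R s) + 1"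
    have B: "B > 0" unfolding B_def by (simp add: add_nonneg_pos)
    have "norm (R t) \<le> norm (1::'a) / (1 - 1 / 2) * norm (R s)"
      if t: "t \<in> K \<inter> ball s (1 / (2 * B))" for t
    proof -
      let ?d = "(t - s) *\<^sub>C (w * R s)"
      have "norm ?d \<le> cmod (t - s) * B" unfolding B_def by (simp add: norm_scaleC mult_left_mono)
      also have "\<dots> \<le> (1 / (2 * B)) * B"
        using t B by (intro mult_right_mono) (auto simp: dist_norm norm_minus_commute)
      finally have d: "norm ?d \<le> 1 / 2" using B by simp
      then have d1: "norm ?d < 1" by simp
      have "?d * (1 - s *\<^sub>C w) = (t - s) *\<^sub>C (w * (R s * (1 - s *\<^sub>C w)))"
        by (simp only: mult_scaleC_left mult.assoc)
      also have "\<dots> = (t - s) *\<^sub>C w"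
        unfolding R_def using alg_inverse(2)[OF inv[OF s]] by simp
      finally have "1 - t *\<^sub>C w = (1 - ?d) * (1 - s *\<^sub>C w)"
        by (simp only: left_diff_distrib mult_1_left scaleC_diff_left) simp
      then have "R t = R s * alg_inverse (1 - ?d)"
        unfolding R_def using alg_invertible_mult(2)[OF neumann_inverse(1)[OF d1] inv[OF s]] by (simp add: R_def)
      then have "norm (R t) \<le> norm (R s) * norm (alg_inverse (1 - ?d))" by (simp add: norm_mult_ineq)
      also have "\<dots> \<le> norm (R s) * (norm (1::'a) / (1 - norm ?d))"
        by (intro mult_left_mono neumann_inverse(2) d1) simp
      also have "\<dots> \<le> norm (R s) * (norm (1::'a) / (1 - 1 / 2))"
        using d by (intro mult_left_mono divide_left_mono) auto
      finally show ?thesis by (simp add: mult_ac)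
    qed
    moreover have "1 / (2 * B) > 0" using B by simp
    ultimately show ?thesis by blast
  qed
  then obtain e M where eM: "\<And>s. s \<in> K \<Longrightarrow> e s > 0"
      "\<And>s t. s \<in> K \<Longrightarrow> t \<in> K \<inter> ball s (e s) \<Longrightarrow> norm (R t) \<le> M s" by metis
  obtain C where C: "C \<subseteq> K" "finite C" "K \<subseteq> (\<Union>c\<in>C. ball c (e c))"
    by (rule compactE_image[OF \<open>compact K\<close>, of K "\<lambda>s. ball s (e s)"])
       (use eM in \<open>auto intro: centre_in_ball[THEN iffD2]\<close>)
  show ?thesis
  proof (rule that)
    show "(\<Sum>c\<in>C. \<bar>M c\<bar>) \<ge> 0" by (intro sum_nonneg) simp
    fix s assume s: "s \<in> K"
    then obtain c where c: "c \<in> C" "s \<in> ball c (e c)" using C by blast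
    then have "norm (R s) \<le> M c" using eM(2)[of c s] C s by blast
    also have "\<dots> \<le> \<bar>M c\<bar>" by simp
    also have "\<dots> \<le> (\<Sum>c\<in>C. \<bar>M c\<bar>)" by (rule member_le_sum) (use C c in auto)
    finally show "norm (alg_inverse (1 - s *\<^sub>C w)) \<le> (\<Sum>c\<in>C. \<bar>M c\<bar>)" by (simp add: R_def)
  qed
qed

section \<open>Resolvents of dyadic powers\<close>

text \<open>
  These are the partial fractions of \<open>1 / (1 - X\<^sup>2)\<close>.  The product form and the mean form of the same
  inverse are both needed: the mean form makes estimates pass from \<open>X\<close> to \<open>X\<^sup>2\<close>, and comparing the two
  forms in a limit gives idempotency.
\<close>

lemma alg_inverse_one_diff_square:
  fixes X :: "'a::complex_banach_algebra_1"
  assumes "alg_invertible (1 - X)" "alg_invertible (1 + X)"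
  shows "alg_invertible (1 - X * X)"
    and "alg_inverse (1 - X * X) = alg_inverse (1 - X) * alg_inverse (1 + X)"
    and "alg_inverse (1 - X) * alg_inverse (1 + X) =
         (1 / 2) *\<^sub>R (alg_inverse (1 - X) + alg_inverse (1 + X))"
proof -
  have "1 - X * X = (1 + X) * (1 - X)" by (simp add: algebra_simps)
  with alg_invertible_mult[OF assms(2,1)]
  show "alg_invertible (1 - X * X)"
    "alg_inverse (1 - X * X) = alg_inverse (1 - X) * alg_inverse (1 + X)" by simp_all
  let ?A = "alg_inverse (1 - X)" and ?B = "alg_inverse (1 + X)"
  have "?A + ?B = ?A * ((1 + X) * ?B) + (?A * (1 - X)) * ?B"
    using alg_inverse[OF assms(1)] alg_inverse[OF assms(2)] by simp
  also have "\<dots> = ?A * ((1 + X) + (1 - X)) * ?B"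
    by (simp only: distrib_left distrib_right mult.assoc)
  also have "(1 + X) + (1 - X) = 2 *\<^sub>R 1" by (simp add: scaleR_2)
  finally show "?A * ?B = (1 / 2) *\<^sub>R (?A + ?B)" by simp
qed

text \<open>
  With \<open>n = 2 ^ k\<close> and \<open>u = 1\<close> this is the mean of \<open>(1 - s *\<^sub>C w)\<^sup>-\<^sup>1\<close> over the \<open>n\<close>-th
  roots of unity \<open>s\<close>, that is, a Riemann sum of the contour integral that defines the Riesz idempotent
  of the unit disc.
\<close>

definition dyadic_resolvent :: "'a::complex_banach_algebra_1 \<Rightarrow> nat \<Rightarrow> complex \<Rightarrow> 'a" where
  "dyadic_resolvent w k u = alg_inverse (1 - u *\<^sub>C w ^ (2 ^ k))"

lemma dyadic_invertible:
  fixes w :: "'a::complex_banach_algebra_1"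
  assumes circle: "\<And>s. cmod s = 1 \<Longrightarrow> alg_invertible (1 - s *\<^sub>C w)"
  shows "cmod u = 1 \<Longrightarrow> alg_invertible (1 - u *\<^sub>C w ^ (2 ^ k))"
proof (induction k arbitrary: u)
  case 0 then show ?case using circle by simp
next
  case (Suc k)
  define r where "r = csqrt u"
  have r: "u = r * r" "cmod r = 1" "cmod (- r) = 1"
    using Suc.prems by (simp_all add: r_def norm_csqrt flip: power2_eq_square)
  have "1 - u *\<^sub>C w ^ (2 ^ Suc k) = 1 - (r *\<^sub>C w ^ (2 ^ k)) * (r *\<^sub>C w ^ (2 ^ k))"
    by (simp add: r(1) scaleC_simps mult_2 power_add)
  then show ?case
    using alg_inverse_one_diff_square(1)[of "r *\<^sub>C w ^ (2 ^ k)"]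
      Suc.IH[OF r(2)] Suc.IH[OF r(3)] by (simp add: scaleC_minus_left)
qed

lemma dyadic_resolvent_square:
  fixes w :: "'a::complex_banach_algebra_1"
  assumes circle: "\<And>s. cmod s = 1 \<Longrightarrow> alg_invertible (1 - s *\<^sub>C w)" and r: "cmod r = 1"
  shows "dyadic_resolvent w (Suc k) (r * r) = dyadic_resolvent w k r * dyadic_resolvent w k (- r)"
    and "dyadic_resolvent w (Suc k) (r * r) =
         (1 / 2) *\<^sub>R (dyadic_resolvent w k r + dyadic_resolvent w k (- r))"
proof -
  have "1 - (r * r) *\<^sub>C w ^ (2 ^ Suc k) = 1 - (r *\<^sub>C w ^ (2 ^ k)) * (r *\<^sub>C w ^ (2 ^ k))"
    by (simp add: scaleC_simps mult_2 power_add)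
  moreover have "cmod (- r) = 1" using r by simp
  note * = dyadic_invertible[of w, OF circle r, of k] dyadic_invertible[of w, OF circle this, of k]
  ultimately show "dyadic_resolvent w (Suc k) (r * r) =
      dyadic_resolvent w k r * dyadic_resolvent w k (- r)"
    "dyadic_resolvent w (Suc k) (r * r) =
         (1 / 2) *\<^sub>R (dyadic_resolvent w k r + dyadic_resolvent w k (- r))"
    using alg_inverse_one_diff_square(2,3)[of "r *\<^sub>C w ^ (2 ^ k)"] *
    by (simp_all add: dyadic_resolvent_def scaleC_minus_left)
qed

text \<open>
  By the parallelogram law, one of \<open>r + s\<close> and \<open>r - s\<close> has modulus at least \<open>sqrt 2\<close>, and their product
  is \<open>u - v\<close>.  Choosing the sign of \<open>s\<close> well therefore makes the square roots closer together than the
  squares by the factor \<open>sqrt 2\<close>.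
\<close>

lemma unit_square_roots_contract:
  assumes "cmod u = 1" "cmod v = 1"
  obtains r s where "cmod r = 1" "cmod s = 1" "u = r * r" "v = s * s"
    "sqrt 2 * cmod (r - s) \<le> cmod (u - v)"
proof -
  note result = that
  define r where "r = csqrt u"
  have r: "cmod r = 1" "u = r * r"
    using assms by (simp_all add: r_def norm_csqrt flip: power2_eq_square)
  have main: thesis if s: "cmod s = 1" "v = s * s" "cmod (r + s) \<ge> sqrt 2" for s
  proof (rule result[OF r(1) s(1) r(2) s(2)])
    have "u - v = (r + s) * (r - s)" by (simp add: r(2) s(2) algebra_simps)
    then have "cmod (u - v) = cmod (r + s) * cmod (r - s)" by (simp add: norm_mult)
    then show "sqrt 2 * cmod (r - s) \<le> cmod (u - v)" using s(3) by (simp add: mult_right_mono)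
  qed
  define s where "s = csqrt v"
  have s: "cmod s = 1" "v = s * s"
    using assms by (simp_all add: s_def norm_csqrt flip: power2_eq_square)
  have "(cmod (r + s))\<^sup>2 + (cmod (r - s))\<^sup>2 = 2 * (cmod r)\<^sup>2 + 2 * (cmod s)\<^sup>2"
    unfolding cmod_power2 by (simp add: power2_eq_square algebra_simps)
  then have "(cmod (r + s))\<^sup>2 \<ge> 2 \<or> (cmod (r - s))\<^sup>2 \<ge> 2" using r s by auto
  then have "cmod (r + s) \<ge> sqrt 2 \<or> cmod (r + - s) \<ge> sqrt 2"
    by (auto intro: real_le_lsqrt)
  then show thesis using main[of s] main[of "- s"] s by auto
qed

text \<open>
  Each squaring step replaces a value at \<open>u\<close> by the mean of the values at both square roots of \<open>u\<close>.
  Averaging does not increase a Lipschitz constant, and the square roots of \<open>u\<close> and \<open>v\<close> can be paired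
  at a distance smaller by \<open>sqrt 2\<close>; so the constant decays geometrically.
\<close>

lemma dyadic_resolvent_lipschitz:
  fixes w :: "'a::complex_banach_algebra_1"
  assumes circle: "\<And>s. cmod s = 1 \<Longrightarrow> alg_invertible (1 - s *\<^sub>C w)"
  obtains L where "\<And>k u v. cmod u = 1 \<Longrightarrow> cmod v = 1 \<Longrightarrow>
      norm (dyadic_resolvent w k u - dyadic_resolvent w k v) \<le> L * (1 / sqrt 2) ^ k * cmod (u - v)"
proof -
  let ?G = "dyadic_resolvent w"
  obtain M where M: "M \<ge> 0" "\<And>s. cmod s = 1 \<Longrightarrow> norm (alg_inverse (1 - s *\<^sub>C w)) \<le> M"
    by (rule resolvent_bounded_on_compact[of "sphere 0 1" w]) (use circle in auto)
  define L where "L = M * norm w * M"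
  have L0: "L \<ge> 0" using M(1) by (simp add: L_def)
  have "norm (?G k u - ?G k v) \<le> L * (1 / sqrt 2) ^ k * cmod (u - v)"
    if "cmod u = 1" "cmod v = 1" for k u v
    using that
  proof (induction k arbitrary: u v)
    case 0
    let ?A = "alg_inverse (1 - u *\<^sub>C w)" and ?B = "alg_inverse (1 - v *\<^sub>C w)"
    have "?G 0 u - ?G 0 v = ?A * ((u - v) *\<^sub>C w) * ?B"
      by (simp add: dyadic_resolvent_def alg_inverse_diff circle 0 scaleC_diff_left)
    then have "norm (?G 0 u - ?G 0 v) \<le> norm (?A * ((u - v) *\<^sub>C w)) * norm ?B"
      by (simp add: norm_mult_ineq)
    also have "\<dots> \<le> (norm ?A * norm ((u - v) *\<^sub>C w)) * norm ?B"
      by (intro mult_right_mono norm_mult_ineq) simp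
    also have "\<dots> \<le> (M * norm ((u - v) *\<^sub>C w)) * M"
      using M 0 by (intro mult_mono) auto
    finally show ?case by (simp add: L_def norm_scaleC mult_ac)
  next
    case (Suc k)
    obtain r s where rs: "cmod r = 1" "cmod s = 1" "u = r * r" "v = s * s"
        "sqrt 2 * cmod (r - s) \<le> cmod (u - v)"
      using unit_square_roots_contract[OF Suc.prems] .
    have square: "?G (Suc k) (r * r) = (1 / 2) *\<^sub>R (?G k r + ?G k (- r))" if "cmod r = 1" for r
      by (rule dyadic_resolvent_square(2)[OF circle that])
    let ?b = "L * (1 / sqrt 2) ^ k * cmod (r - s)"
    have "?G (Suc k) u - ?G (Suc k) v =
        (1 / 2) *\<^sub>R ((?G k r - ?G k s) + (?G k (- r) - ?G k (- s)))"
      unfolding rs(3,4) square[OF rs(1)] square[OF rs(2)] by (simp add: algebra_simps)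
    then have "norm (?G (Suc k) u - ?G (Suc k) v) \<le>
        (1 / 2) * (norm (?G k r - ?G k s) + norm (?G k (- r) - ?G k (- s)))"
      by (simp add: norm_triangle_ineq)
    also have "\<dots> \<le> (1 / 2) * (?b + ?b)"
    proof -
      have "cmod (- r - - s) = cmod (r - s)" by (simp add: norm_minus_commute)
      then have "norm (?G k (- r) - ?G k (- s)) \<le> ?b"
        using Suc.IH[of "- r" "- s"] rs(1,2) by simp
      with Suc.IH[OF rs(1,2)] show ?thesis by (intro mult_left_mono add_mono) simp_all
    qed
    also have "\<dots> = L * (1 / sqrt 2) ^ k * cmod (r - s)" by simp
    also have "\<dots> \<le> L * (1 / sqrt 2) ^ k * (cmod (u - v) / sqrt 2)"
      using rs(5) L0 by (intro mult_left_mono) (simp_all add: field_simps)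
    finally show ?case by simp
  qed
  then show thesis using that by blast
qed

section \<open>The Riesz idempotent of a disc\<close>

lemma alg_invertible_one_diff_dyadic_power:
  fixes x :: "'a::ring_1"
  shows "alg_invertible (1 - x ^ (2 ^ k)) \<Longrightarrow> alg_invertible (1 - x)"
proof (induction k)
  case (Suc k)
  have "1 - x ^ (2 ^ Suc k) = (1 - x ^ (2 ^ k)) * (1 + x ^ (2 ^ k))"
    "1 - x ^ (2 ^ Suc k) = (1 + x ^ (2 ^ k)) * (1 - x ^ (2 ^ k))"
    by (simp_all add: algebra_simps mult_2 power_add)
  then show ?case using Suc alg_invertible_commuting_factor by metis
qed simp

lemma convergent_geometric_steps:
  fixes X :: "nat \<Rightarrow> 'a::banach"
  assumes "\<And>k. norm (X (Suc k) - X k) \<le> C * \<theta> ^ k" "\<bar>\<theta>\<bar> < 1"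
  shows "convergent X"
proof -
  have "summable (\<lambda>k. X (Suc k) - X k)"
    by (rule summable_comparison_test'[where N = 0 and g = "\<lambda>k. C * \<theta> ^ k"])
       (use assms in \<open>auto intro: summable_mult summable_geometric\<close>)
  then have "convergent (\<lambda>n. \<Sum>k<n. X (Suc k) - X k)" by (simp add: summable_iff_convergent)
  then have "convergent (\<lambda>n. X n - X 0)" by (simp add: sum_lessThan_telescope)
  then show ?thesis by (simp add: convergent_diff_const_right_iff)
qed

text \<open>
  This is the Riesz idempotent \<open>p\<close> of \<open>w\<close> for the unit disc, obtained as the limit of
  \<open>P k = (1 - w ^ (2 ^ k))\<^sup>-\<^sup>1\<close>: on the part of the spectrum inside the disc the powers tend to 0 and
  the limit is 1, outside they tend to infinity and the limit is 0.

  With \<open>Q k = (1 + w ^ (2 ^ k))\<^sup>-\<^sup>1\<close>, the step from \<open>P k\<close> to \<open>P (Suc k)\<close> is half of \<open>Q k - P k\<close>, which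
  decays geometrically, so \<open>P\<close> and \<open>Q\<close> converge to the same \<open>p\<close>; the identity \<open>P (Suc k) = P k * Q k\<close>
  then makes \<open>p\<close> idempotent.  Every \<open>P k\<close> commutes with whatever commutes with \<open>w\<close>, hence so does \<open>p\<close>.
  The element \<open>v\<close> is the inverse of \<open>w\<close> in the corner of \<open>1 - p\<close>.
\<close>

lemma riesz_idempotent_unit_circle:
  fixes w :: "'a::complex_banach_algebra_1"
  assumes circle: "\<And>s. cmod s = 1 \<Longrightarrow> alg_invertible (1 - s *\<^sub>C w)"
  obtains p v where "p \<in> double_commutant {w}" "p * p = p"
    "\<And>s. cmod s \<le> 1 \<Longrightarrow> alg_invertible (1 - s *\<^sub>C (w * p))"
    "w * v = 1 - p" "v * w = 1 - p" "p * v = 0" "v * p = 0"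
proof -
  define P where "P k = dyadic_resolvent w k 1" for k
  define Q where "Q k = dyadic_resolvent w k (-1)" for k
  obtain L where L: "\<And>k u v. cmod u = 1 \<Longrightarrow> cmod v = 1 \<Longrightarrow>
      norm (dyadic_resolvent w k u - dyadic_resolvent w k v) \<le> L * (1 / sqrt 2) ^ k * cmod (u - v)"
    using dyadic_resolvent_lipschitz[of w, OF circle] by blast
  have PQ: "norm (Q k - P k) \<le> 2 * L * (1 / sqrt 2) ^ k" for k
    using L[of "-1" 1 k] by (simp add: P_def Q_def mult_ac)
  have PS: "P (Suc k) = P k * Q k" "P (Suc k) = (1 / 2) *\<^sub>R (P k + Q k)" for k
    using dyadic_resolvent_square[of w 1 k, OF circle] by (simp_all add: P_def Q_def)
  have "P (Suc k) - P k = (1 / 2) *\<^sub>R (Q k - P k)" for k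
    using scaleR_add_left[of "1/2" "1/2" "P k"] by (simp add: PS(2) algebra_simps)
  then have "norm (P (Suc k) - P k) \<le> L * (1 / sqrt 2) ^ k" for k
    using PQ[of k] by simp
  then have "convergent P" by (rule convergent_geometric_steps) auto
  then obtain p where Pp: "P \<longlonglongrightarrow> p" by (auto simp: convergent_def)
  have "(\<lambda>k. 2 * L * (1 / sqrt 2) ^ k) \<longlonglongrightarrow> 2 * L * 0"
    by (intro tendsto_mult tendsto_const LIMSEQ_power_zero) auto
  then have geometric: "(\<lambda>k. 2 * L * (1 / sqrt 2) ^ k) \<longlonglongrightarrow> 0" by simp
  have "(\<lambda>k. Q k - P k) \<longlonglongrightarrow> 0"
    by (rule Lim_null_comparison[OF _ geometric]) (use PQ in simp)
  from tendsto_add[OF this Pp] have Qp: "Q \<longlonglongrightarrow> p" by simp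
  have "(\<lambda>k. P k * Q k) \<longlonglongrightarrow> p" using LIMSEQ_Suc[OF Pp] by (simp add: PS(1))
  with tendsto_mult[OF Pp Qp] have idem: "p * p = p" by (rule LIMSEQ_unique)

  have inv: "alg_invertible (1 - w ^ (2 ^ k))" for k
    using dyadic_invertible[of w 1 k, OF circle] by (simp add: scaleC_one)
  have P: "P k = alg_inverse (1 - w ^ (2 ^ k))" for k
    by (simp add: P_def dyadic_resolvent_def scaleC_one)
  have P1: "(1 - w ^ (2 ^ k)) * P k = 1" "P k * (1 - w ^ (2 ^ k)) = 1" for k
    unfolding P by (simp_all add: alg_inverse inv)
  have Pcomm: "P k * y = y * P k" if "w * y = y * w" for k y
  proof -
    have "w ^ (2 ^ k) * y = y * w ^ (2 ^ k)"
      using power_commuting_commutes[OF that] .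
    then show ?thesis unfolding P by (intro alg_inverse_commute inv) (simp add: algebra_simps)
  qed
  have pcomm: "p * y = y * p" if "w * y = y * w" for y
  proof -
    have "(\<lambda>k. P k * y) \<longlonglongrightarrow> p * y"
      by (rule tendsto_mult[OF Pp tendsto_const])
    moreover have "(\<lambda>k. P k * y) \<longlonglongrightarrow> y * p"
      unfolding Pcomm[OF that] by (rule tendsto_mult[OF tendsto_const Pp])
    ultimately show ?thesis by (rule LIMSEQ_unique)
  qed
  have bicomm: "p \<in> double_commutant {w}"
    using pcomm by (auto simp: commutant_def)
  have pw: "w * p = p * w" using pcomm[of w] by simp
  have Pp_comm: "P k * p = p * P k" for k using Pcomm[OF pw] .

  \<comment> \<open>Some power of \<open>w * p\<close> has norm below 1, so \<open>1 - s *\<^sub>C (w * p)\<close> divides an element that is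
    invertible by the Neumann series.\<close>
  have inside: "alg_invertible (1 - s *\<^sub>C (w * p))" if s: "cmod s \<le> 1" for s
  proof -
    have "(\<lambda>k. p * P k - p) \<longlonglongrightarrow> p * p - p"
      by (intro tendsto_intros Pp)
    then have "(\<lambda>k. p * P k - p) \<longlonglongrightarrow> 0" by (simp add: idem)
    then have "eventually (\<lambda>k. norm (p * P k - p) < 1 / 2) sequentially"
      by (rule order_tendstoD(2)[OF tendsto_norm_zero]) simp
    then obtain k where k: "norm (p * P k - p) < 1 / 2" by (auto dest: eventually_happens)
    \<comment> \<open>\<open>t\<close> equals \<open>p * w ^ n * P k\<close>; that it is small makes \<open>y\<close>, which satisfies \<open>y = t - t * y\<close>, small.\<close>
    define t where "t = p * P k - p"
    define n where "n = (2::nat) ^ k"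
    define y where "y = p * w ^ n"
    have "t * p = p * (P k * p) - p * p" by (simp add: t_def left_diff_distrib mult.assoc)
    also have "\<dots> = (p * p) * P k - p * p" by (simp add: Pp_comm mult.assoc)
    finally have "t * p = t" by (simp add: idem t_def)
    then have "t * y = t * w ^ n" by (metis y_def mult.assoc)
    moreover have "t * (1 - w ^ n) = y"
      using P1(2)[of k] by (simp add: t_def y_def n_def left_diff_distrib mult.assoc)
        (simp add: right_diff_distrib)
    ultimately have y: "y = t - t * y" by (simp add: right_diff_distrib)
    have "norm y \<le> norm t + norm (t * y)" by (subst y) (rule norm_triangle_ineq4)
    also have "\<dots> \<le> norm t + norm t * norm y" by (simp add: norm_mult_ineq)
    also have "\<dots> \<le> norm t + (1 / 2) * norm y"
      using k by (intro add_mono mult_right_mono) (simp_all add: t_def)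
    finally have y1: "norm y < 1" using k by (simp add: t_def)
    have "(w * p) ^ Suc m = p * w ^ Suc m" for m
    proof (induction m)
      case (Suc m)
      have "(w * p) ^ Suc (Suc m) = w * p * (p * w ^ Suc m)" unfolding Suc[symmetric] by simp
      also have "\<dots> = p * w ^ Suc (Suc m)"
        by (metis pw idem mult.assoc power_Suc)
      finally show ?case .
    qed (simp add: pw)
    moreover have "n = Suc (n - 1)" by (simp add: n_def)
    ultimately have "(w * p) ^ n = y" unfolding y_def by metis
    then have "(s *\<^sub>C (w * p)) ^ n = s ^ n *\<^sub>C y" by (simp add: scaleC_power)
    moreover have "norm (s ^ n *\<^sub>C y) < 1"
    proof -
      have "cmod s ^ n * norm y \<le> 1 * norm y" using s by (intro mult_right_mono power_le_one) auto
      then show ?thesis using y1 by (simp add: norm_scaleC norm_power)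
    qed
    ultimately have "alg_invertible (1 - (s *\<^sub>C (w * p)) ^ (2 ^ k))"
      using neumann_inverse(1) by (simp add: n_def)
    then show ?thesis by (rule alg_invertible_one_diff_dyadic_power)
  qed

  \<comment> \<open>In the complementary corner, \<open>- w ^ (2 ^ k) * P k = 1 - P k\<close> is close to the identity of the
    corner, so \<open>w\<close> is a factor of an element invertible there; \<open>d\<close> measures the distance.\<close>
  define f where "f = 1 - p"
  have f: "f * p = 0" "f * f = f" by (simp_all add: f_def algebra_simps idem)
  have fcomm: "f * y = y * f" if "w * y = y * w" for y
    using pcomm[OF that] by (simp add: f_def algebra_simps)
  have "(\<lambda>k. f * P k) \<longlonglongrightarrow> f * p" by (intro tendsto_intros Pp)
  then have "(\<lambda>k. f * P k) \<longlonglongrightarrow> 0" by (simp add: f)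
  then have "eventually (\<lambda>k. norm (f * P k) < 1) sequentially"
    by (rule order_tendstoD(2)[OF tendsto_norm_zero]) simp
  then obtain k where k: "norm (f * P k) < 1" by (auto dest: eventually_happens)
  define d where "d = f * P k"
  define n where "n = (2::nat) ^ k"
  define E where "E = alg_inverse (1 - d)"
  have dinv: "alg_invertible (1 - d)" using neumann_inverse(1) k by (simp add: d_def)
  define v where "v = - (w ^ (n - 1) * P k * f * E)"
  have wP: "w * P k = P k * w" using Pcomm[of w] by simp
  have wf: "w * f = f * w" using fcomm[of w] by simp
  have wd: "w * d = d * w" unfolding d_def by (intro commute_mult wP wf)
  then have wE: "w * E = E * w"
    unfolding E_def using alg_inverse_commute[OF dinv, of w] by (simp add: algebra_simps)
  have "w * w ^ (n - 1) = w ^ n" by (simp add: n_def flip: power_Suc)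
  then have "w * v = - (w ^ n * P k * f * E)" by (simp add: v_def flip: mult.assoc)
  also have "w ^ n * P k = P k - 1"
    using P1(1)[of k] by (simp add: n_def left_diff_distrib algebra_simps)
  also have "(P k - 1) * f = - (f * (1 - d))"
  proof -
    have "f * d = d" by (simp add: d_def f flip: mult.assoc)
    moreover have "P k * f = d" using fcomm[OF wP] by (simp add: d_def)
    ultimately show ?thesis by (simp add: algebra_simps)
  qed
  finally have wv: "w * v = 1 - p"
    using alg_inverse(1)[OF dinv] by (simp add: E_def mult.assoc f_def)
  have "w * w ^ (n - 1) = w ^ (n - 1) * w" by (simp add: power_commutes)
  from this have "w * (w ^ (n - 1) * P k * f * E) = w ^ (n - 1) * P k * f * E * w"
    by (intro commute_mult wP wf wE)
  then have comm: "w * v = v * w" by (simp add: v_def)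
  have "v = - (w ^ (n - 1) * P k * E * f)"
    using fcomm[OF wE] by (simp add: v_def mult.assoc)
  then have vp: "v * p = 0" by (simp add: f mult.assoc)
  show thesis
    using that[OF bicomm idem inside wv _ _ vp] wv comm vp pcomm[OF comm] by simp
qed

lemma alg_invertible_diff_iff_one_diff:
  fixes b :: "'a::complex_banach_algebra_1"
  assumes "z \<noteq> 0"
  shows "alg_invertible (b - z *\<^sub>C 1) \<longleftrightarrow> alg_invertible (1 - (1 / z) *\<^sub>C b)"
proof -
  have "b - z *\<^sub>C 1 = (- z) *\<^sub>C (1 - (1 / z) *\<^sub>C b)"
    using assms by (simp add: scaleC_simps)
  then show ?thesis using alg_invertible_scaleC_iff[of "- z"] assms by simp
qed

lemma riesz_idempotent_disc:
  fixes a :: "'a::complex_banach_algebra_1"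
  assumes "r > 0" and circle: "\<And>z. cmod z = r \<Longrightarrow> alg_invertible (a - z *\<^sub>C 1)"
  obtains p v where "p \<in> double_commutant {a}" "p * p = p"
    "\<And>z. cmod z \<ge> r \<Longrightarrow> alg_invertible (a * p - z *\<^sub>C 1)"
    "a * v = 1 - p" "v * a = 1 - p" "p * v = 0" "v * p = 0"
proof -
  define c where "c = complex_of_real (1 / r)"
  define w where "w = c *\<^sub>C a"
  have c: "c \<noteq> 0" "cmod c = 1 / r" using \<open>r > 0\<close> by (simp_all add: c_def norm_divide)
  have "alg_invertible (1 - s *\<^sub>C w)" if "cmod s = 1" for s
  proof -
    have sc: "s * c \<noteq> 0" using that c by auto
    have "cmod (1 / (s * c)) = r" using that c by (simp add: norm_divide norm_mult)
    from circle[OF this] show ?thesis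
      using alg_invertible_diff_iff_one_diff[of "1 / (s * c)" a] sc
      by (simp add: w_def scaleC_simps)
  qed
  from riesz_idempotent_unit_circle[OF this]
  obtain p v where pv: "p \<in> double_commutant {w}" "p * p = p"
    "\<And>s. cmod s \<le> 1 \<Longrightarrow> alg_invertible (1 - s *\<^sub>C (w * p))"
    "w * v = 1 - p" "v * w = 1 - p" "p * v = 0" "v * p = 0" by blast
  show thesis
  proof (rule that)
    have "commutant {w} = commutant {a}"
      using c by (auto simp: commutant_def w_def scaleC_simps)
         (metis scaleC_scaleC scaleC_one divide_inverse right_inverse mult.commute)
    then show "p \<in> double_commutant {a}" using pv(1) by simp
    show "p * p = p" by (rule pv)
    show "alg_invertible (a * p - z *\<^sub>C 1)" if z: "cmod z \<ge> r" for z
    proof -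
      have z0: "z \<noteq> 0" using z \<open>r > 0\<close> by auto
      have "cmod (1 / (z * c)) \<le> 1" using z z0 c \<open>r > 0\<close> by (simp add: norm_divide norm_mult)
      from pv(3)[OF this] show ?thesis
        using z0 c by (simp add: alg_invertible_diff_iff_one_diff w_def scaleC_simps)
    qed
    show "a * (c *\<^sub>C v) = 1 - p" "(c *\<^sub>C v) * a = 1 - p"
      using pv(4,5) by (simp_all add: w_def scaleC_simps)
    show "p * (c *\<^sub>C v) = 0" "(c *\<^sub>C v) * p = 0"
      using pv(6,7) by (simp_all add: scaleC_simps)
  qed
qed

section \<open>Isolated spectral points\<close>

text \<open>
  On the corner of \<open>p\<close>, the element \<open>a * p - z *\<^sub>C 1\<close> agrees with \<open>a - z *\<^sub>C 1\<close>; on the corner of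
  \<open>1 - p\<close> it is the scalar \<open>- z\<close>.
\<close>

lemma alg_invertible_compression_diff:
  fixes a p :: "'a::complex_banach_algebra_1"
  assumes "p * p = p" "a * p = p * a" "z \<noteq> 0" "alg_invertible (a - z *\<^sub>C 1)"
  shows "alg_invertible (a * p - z *\<^sub>C 1)"
proof -
  let ?u = "a * p - z *\<^sub>C 1" and ?R = "alg_inverse (a - z *\<^sub>C 1)"
  have R: "?R * p = p * ?R"
    using assms(4) by (rule alg_inverse_commute) (simp add: assms(2) algebra_simps scaleC_simps)
  have absorb: "a * p * p = a * p" "p * (a * p) = p * a" using assms(1,2) by (metis mult.assoc)+
  have up: "?u * p = (a - z *\<^sub>C 1) * p" "p * ?u = p * (a - z *\<^sub>C 1)"
    by (simp_all add: left_diff_distrib right_diff_distrib scaleC_simps absorb)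
  have uf: "?u * (1 - p) = (- z) *\<^sub>C (1 - p)" "(1 - p) * ?u = (- z) *\<^sub>C (1 - p)"
    using up by (simp_all add: algebra_simps scaleC_simps assms(2))
  show ?thesis
  proof (rule alg_invertible_split)
    have "?u * (?R * p) = ?u * p * ?R" by (simp add: R mult.assoc)
    also have "\<dots> = (a - z *\<^sub>C 1) * (p * ?R)" by (simp add: up mult.assoc)
    also have "\<dots> = p" by (simp add: alg_inverse_cancel(1)[OF assms(4)] flip: R)
    finally show "?u * (?R * p) = p" .
    have "?R * p * ?u = ?R * (p * (a - z *\<^sub>C 1))" by (simp add: up mult.assoc)
    also have "\<dots> = p * (?R * (a - z *\<^sub>C 1))" by (simp add: R flip: mult.assoc)
    finally show "?R * p * ?u = p" by (simp add: alg_inverse[OF assms(4)])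
    show "?u * ((- 1 / z) *\<^sub>C (1 - p)) = 1 - p" "((- 1 / z) *\<^sub>C (1 - p)) * ?u = 1 - p"
      unfolding mult_scaleC_right mult_scaleC_left uf scaleC_scaleC using assms(3)
      by (simp_all add: scaleC_one)
  qed
qed

text \<open>
  Here \<open>q = a * x\<close> is an idempotent, and \<open>x\<close> inverts \<open>a\<close> in the corner of \<open>q\<close>, which by the Neumann
  series survives the subtraction of a small \<open>z\<close>.  In the corner of \<open>1 - q\<close>, the elements \<open>a\<close> and
  \<open>a - a\<^sup>2 * x\<close> agree.
\<close>

lemma alg_invertible_diff_if_outer_inverse:
  fixes a x :: "'a::complex_banach_algebra_1"
  assumes ax: "a * x = x * a" and xax: "x * a * x = x"
    and small: "cmod z * norm x < 1"
    and rest: "alg_invertible (a - a\<^sup>2 * x - z *\<^sub>C 1)"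
  shows "alg_invertible (a - z *\<^sub>C 1)"
proof -
  let ?u = "a - z *\<^sub>C 1" and ?N = "a - a\<^sup>2 * x - z *\<^sub>C 1"
  define q where "q = a * x"
  have q: "q * q = q" "a * q = q * a" "q * x = x" "x * q = x"
    unfolding q_def using ax xax by (metis mult.assoc)+
  have N: "?N = a * (1 - q) - z *\<^sub>C 1"
    by (simp add: q_def power2_eq_square algebra_simps)
  define E where "E = alg_inverse (1 - z *\<^sub>C x)"
  have inv: "alg_invertible (1 - z *\<^sub>C x)" using small by (intro neumann_inverse(1)) (simp add: norm_scaleC)
  have xE: "x * E = E * x"
    unfolding E_def using alg_inverse_commute[OF inv, of x] by (simp add: algebra_simps scaleC_simps)
  have ux: "?u * x = q * (1 - z *\<^sub>C x)" "x * ?u = (1 - z *\<^sub>C x) * q"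
    using q ax by (simp_all add: q_def algebra_simps scaleC_simps)
  define R where "R = alg_inverse ?N"
  have absorb: "q * q = q" "q * a = a * q" "a * q * q = a * q" "q * (a * q) = a * q"
    using q(1,2) by (metis mult.assoc)+
  have "?N * q = q * ?N"
    unfolding N by (simp add: left_diff_distrib right_diff_distrib scaleC_simps absorb)
  from alg_inverse_commute[OF rest this] have Rq: "R * q = q * R" by (simp add: R_def)
  have uf: "?u * (1 - q) = ?N * (1 - q)" "(1 - q) * ?u = (1 - q) * ?N"
    unfolding N by (simp_all add: left_diff_distrib right_diff_distrib scaleC_simps absorb)
  have Rf: "R * (1 - q) = (1 - q) * R" by (simp add: algebra_simps Rq)
  show ?thesis
  proof (rule alg_invertible_split)
    show "?u * (x * E) = q"
      using alg_inverse(1)[OF inv] by (simp add: ux E_def mult.assoc flip: mult.assoc[of ?u])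
    show "x * E * ?u = q"
      using alg_inverse_cancel(2)[OF inv] by (simp add: xE ux mult.assoc) (simp add: E_def)
    have "?u * ((1 - q) * R) = ?N * ((1 - q) * R)" by (simp only: uf flip: mult.assoc)
    also have "\<dots> = ?N * (R * (1 - q))" by (simp only: Rf)
    also have "\<dots> = 1 - q" unfolding R_def by (rule alg_inverse_cancel(1)[OF rest])
    finally show "?u * ((1 - q) * R) = 1 - q" .
    have "(1 - q) * R * ?u = R * ((1 - q) * ?u)" by (simp only: Rf flip: mult.assoc)
    also have "\<dots> = (1 - q) * (R * ?N)" by (simp only: uf Rf flip: mult.assoc)
    finally show "(1 - q) * R * ?u = 1 - q" unfolding R_def by (simp add: alg_inverse(2)[OF rest])
  qed
qed

lemma double_commutant_commute:
  assumes "p \<in> double_commutant {a}"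
  shows "a * p = p * a"
  using assms by (auto simp: commutant_def)

text \<open>
  Koliha's characterisation: generalized Drazin invertibility of \<open>a\<close> means that 0 is not an
  accumulation point of the spectrum.  It turns membership in \<open>acc_elems\<close> into a statement about
  spectra alone.  For the converse implication, a small circle around 0 lies in the resolvent set and
  its Riesz idempotent splits off a quasinilpotent part.
\<close>

lemma gen_drazin_invertible_iff:
  fixes a :: "'a::complex_banach_algebra_1"
  shows "a \<in> gen_drazin_invertibles \<longleftrightarrow>
    (\<exists>e>0. \<forall>z. 0 < cmod z \<and> cmod z < e \<longrightarrow> alg_invertible (a - z *\<^sub>C 1))"
proof
  assume "a \<in> gen_drazin_invertibles"
  then obtain x where x: "a * x = x * a" "x * a * x = x" "alg_spectrum (a - a\<^sup>2 * x) = {0}"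
    by (auto simp: gen_drazin_invertibles_def commutant_def quasinilpotents_def)
  let ?e = "1 / (norm x + 1)"
  have pos: "norm x + 1 > 0" by (simp add: add_nonneg_pos)
  have "alg_invertible (a - z *\<^sub>C 1)" if "0 < cmod z" "cmod z < ?e" for z
  proof (rule alg_invertible_diff_if_outer_inverse[OF x(1,2)])
    have "cmod z * norm x \<le> cmod z * (norm x + 1)" by (simp add: mult_left_mono)
    also have "\<dots> < 1" using that(2) pos by (simp add: field_simps)
    finally show "cmod z * norm x < 1" .
    have "z \<notin> alg_spectrum (a - a\<^sup>2 * x)" using x(3) that by auto
    then show "alg_invertible (a - a\<^sup>2 * x - z *\<^sub>C 1)" by (simp add: alg_spectrum_def)
  qed
  then show "\<exists>e>0. \<forall>z. 0 < cmod z \<and> cmod z < e \<longrightarrow> alg_invertible (a - z *\<^sub>C 1)"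
    using pos by (intro exI[of _ ?e]) auto
next
  assume "\<exists>e>0. \<forall>z. 0 < cmod z \<and> cmod z < e \<longrightarrow> alg_invertible (a - z *\<^sub>C 1)"
  then obtain e where e: "e > 0" "\<And>z. 0 < cmod z \<Longrightarrow> cmod z < e \<Longrightarrow> alg_invertible (a - z *\<^sub>C 1)"
    by blast
  show "a \<in> gen_drazin_invertibles"
  \<comment> \<open>Quasinilpotents have spectrum exactly \<open>{0}\<close>.  If \<open>a\<close> is invertible, then the quasinilpotent part
    must be 0; otherwise \<open>a * p\<close> is not invertible, which puts 0 into its spectrum.\<close>
  proof (cases "alg_invertible a")
    case True
    have "alg_spectrum (0::'a) = {0}"
    proof -
      have "alg_invertible (0 - z *\<^sub>C (1::'a)) \<longleftrightarrow> z \<noteq> 0" for z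
        using alg_invertible_scaleC_iff[of "- z" "1::'a"]
        by (cases "z = 0") (auto simp: scaleC_minus_left alg_invertible_def)
      then show ?thesis by (auto simp: alg_spectrum_def)
    qed
    moreover have "a - a\<^sup>2 * alg_inverse a = 0"
      by (simp add: power2_eq_square mult.assoc alg_inverse[OF True])
    ultimately have "a - a\<^sup>2 * alg_inverse a \<in> quasinilpotents" by (simp add: quasinilpotents_def)
    moreover have "alg_inverse a \<in> commutant {a}" "alg_inverse a * a * alg_inverse a = alg_inverse a"
      by (simp_all add: commutant_def alg_inverse[OF True])
    ultimately show ?thesis unfolding gen_drazin_invertibles_def by blast
  next
    case False
    have "alg_invertible (a - z *\<^sub>C 1)" if "cmod z = e / 2" for z
    proof -
      have "0 < cmod z" "cmod z < e" using that e(1) by linarith+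
      then show ?thesis by (rule e(2))
    qed
    moreover have "e / 2 > 0" using e(1) by simp
    ultimately obtain p v where pv: "p \<in> double_commutant {a}" "p * p = p"
      "\<And>z. cmod z \<ge> e / 2 \<Longrightarrow> alg_invertible (a * p - z *\<^sub>C 1)"
      "a * v = 1 - p" "v * a = 1 - p" "p * v = 0" "v * p = 0"
      using riesz_idempotent_disc[of "e / 2" a] by blast
    have ap: "a * p = p * a" using pv(1) by (rule double_commutant_commute)
    have "a - a\<^sup>2 * v = a - a * (a * v)" by (simp add: power2_eq_square mult.assoc)
    also have "\<dots> = a * p" by (simp add: pv(4) right_diff_distrib)
    finally have rest: "a - a\<^sup>2 * v = a * p" .
    have "alg_invertible (a * p - z *\<^sub>C 1)" if "z \<noteq> 0" for z
    proof (cases "cmod z \<ge> e / 2")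
      case False
      then have "alg_invertible (a - z *\<^sub>C 1)" using e that by simp
      then show ?thesis by (rule alg_invertible_compression_diff[OF pv(2) ap that])
    qed (rule pv(3))
    moreover have "\<not> alg_invertible (a * p)"
    proof
      assume inv: "alg_invertible (a * p)"
      have "a * p * (1 - p) = 0" by (simp add: right_diff_distrib mult.assoc pv(2))
      then have "1 - p = 0" using alg_inverse_cancel(2)[OF inv, of "1 - p"] by simp
      then show False using inv False by simp
    qed
    ultimately have "alg_spectrum (a * p) = {0}" by (auto simp: alg_spectrum_def)
    moreover have "v * a * v = v" by (simp add: pv(5,6) left_diff_distrib)
    moreover have "v \<in> commutant {a}" by (simp add: commutant_def pv(4,5))
    ultimately have "v \<in> commutant {a} \<and> v * a * v = v \<and> a - a\<^sup>2 * v \<in> quasinilpotents"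
      by (simp add: quasinilpotents_def rest)
    then show ?thesis unfolding gen_drazin_invertibles_def by blast
  qed
qed

lemma acc_elems_iff:
  fixes a :: "'a::complex_banach_algebra_1"
  shows "a \<in> acc_elems \<longleftrightarrow> (\<forall>z. z \<noteq> 0 \<longrightarrow>
    (\<exists>e>0. \<forall>y. 0 < dist z y \<and> dist z y < e \<longrightarrow> alg_invertible (a - y *\<^sub>C 1)))"
proof -
  have "a - z *\<^sub>C 1 \<in> gen_drazin_invertibles \<longleftrightarrow>
      (\<exists>e>0. \<forall>y. 0 < dist z y \<and> dist z y < e \<longrightarrow> alg_invertible (a - y *\<^sub>C 1))" for z
  proof -
    have shift: "a - z *\<^sub>C 1 - h *\<^sub>C 1 = a - (z + h) *\<^sub>C 1" for h by (simp add: scaleC_simps)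
    have "(\<forall>h. 0 < cmod h \<and> cmod h < e \<longrightarrow> alg_invertible (a - (z + h) *\<^sub>C 1)) \<longleftrightarrow>
        (\<forall>y. 0 < dist z y \<and> dist z y < e \<longrightarrow> alg_invertible (a - y *\<^sub>C 1))"
      (is "?L = ?R") for e
    proof
      assume L: ?L
      show ?R
      proof (intro allI impI)
        fix y assume "0 < dist z y \<and> dist z y < e"
        then show "alg_invertible (a - y *\<^sub>C 1)"
          using L[rule_format, of "y - z"] by (simp add: dist_norm norm_minus_commute)
      qed
    next
      assume R: ?R
      show ?L
      proof (intro allI impI)
        fix h assume "0 < cmod h \<and> cmod h < e"
        then show "alg_invertible (a - (z + h) *\<^sub>C 1)"
          using R[rule_format, of "z + h"] by (simp add: dist_norm)
      qed
    qed
    then show ?thesis by (simp add: gen_drazin_invertible_iff shift)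
  qed
  then show ?thesis by (simp add: acc_elems_def)
qed

section \<open>Spectral idempotents of ag-Drazin invertible elements\<close>

text \<open>
  The part of \<open>S\<close> inside the punctured disc has no accumulation point there, so it is countable and
  its elements attain only countably many moduli.
\<close>

lemma circle_avoiding_discrete_set:
  fixes S :: "complex set"
  assumes "\<delta> > 0"
    and isolated: "\<And>z. z \<noteq> 0 \<Longrightarrow> cmod z < \<delta> \<Longrightarrow> \<exists>e>0. \<forall>y. 0 < dist z y \<and> dist z y < e \<longrightarrow> y \<notin> S"
  obtains r where "0 < r" "r < \<delta>" "\<And>z. cmod z = r \<Longrightarrow> z \<notin> S"
proof -
  let ?D = "ball 0 \<delta> - {0::complex}"
  have "open ?D" by auto
  moreover have "S sparse_in ?D"
    unfolding sparse_in_def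
  proof
    fix z assume "z \<in> ?D"
    have no_limit: "\<not> y islimpt S" if "y \<in> ?D" for y
    proof -
      have "y \<noteq> 0" "cmod y < \<delta>" using that by auto
      from isolated[OF this] obtain e where e: "e > 0" "\<And>x. 0 < dist y x \<Longrightarrow> dist y x < e \<Longrightarrow> x \<notin> S" by blast
      show ?thesis
      proof
        assume "y islimpt S"
        with e(1) obtain x where "x \<in> S" "x \<noteq> y" "dist x y < e"
          unfolding islimpt_approachable by blast
        then show False using e(2)[of x] by (simp add: dist_commute)
      qed
    qed
    show "\<exists>B. z \<in> B \<and> open B \<and> (\<forall>y\<in>B. \<not> y islimpt S)"
      by (intro exI[of _ ?D] conjI ballI \<open>z \<in> ?D\<close> \<open>open ?D\<close> no_limit)
  qed
  ultimately have "countable (?D \<inter> S)" by (rule sparse_imp_countable)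
  then have "countable (cmod ` (?D \<inter> S))" by (rule countable_image)
  moreover have "uncountable {0<..<\<delta>}" using \<open>\<delta> > 0\<close> by (simp add: uncountable_open_interval)
  ultimately have "\<not> {0<..<\<delta>} \<subseteq> cmod ` (?D \<inter> S)"
    using countable_subset[of "{0<..<\<delta>}"] by metis
  then obtain r where r: "r \<in> {0<..<\<delta>}" "r \<notin> cmod ` (?D \<inter> S)" by (meson subsetI)
  show thesis
  proof (rule that)
    show "0 < r" "r < \<delta>" using r by auto
    show "z \<notin> S" if "cmod z = r" for z
      using r that by (auto simp: image_iff)
  qed
qed

lemma ag_drazin_isolated_near_zero:
  fixes a :: "'a::complex_banach_algebra_1"
  assumes "is_ag_drazin_inverse a x" "z \<noteq> 0" "cmod z * norm x < 1"
  shows "\<exists>e>0. \<forall>y. 0 < dist z y \<and> dist z y < e \<longrightarrow> alg_invertible (a - y *\<^sub>C 1)"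
proof -
  have x: "a * x = x * a" "x * a * x = x" "a - a\<^sup>2 * x \<in> acc_elems"
    using assms(1) by (auto simp: is_ag_drazin_inverse_def commutant_def)
  obtain e1 where e1: "e1 > 0"
    "\<And>y. 0 < dist z y \<Longrightarrow> dist z y < e1 \<Longrightarrow> alg_invertible (a - a\<^sup>2 * x - y *\<^sub>C 1)"
    using x(3) assms(2) unfolding acc_elems_iff by blast
  have "open {y. cmod y * norm x < 1}" by (intro open_Collect_less continuous_intros)
  then obtain e2 where e2: "e2 > 0" "\<And>y. dist z y < e2 \<Longrightarrow> cmod y * norm x < 1"
    using assms(3) by (auto simp: open_contains_ball subset_iff)
  show ?thesis
  proof (intro exI[of _ "min e1 e2"] conjI allI impI)
    show "min e1 e2 > 0" using e1(1) e2(1) by simp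
    fix y assume y: "0 < dist z y \<and> dist z y < min e1 e2"
    show "alg_invertible (a - y *\<^sub>C 1)"
    proof (rule alg_invertible_diff_if_outer_inverse[OF x(1,2)])
      show "cmod y * norm x < 1" using e2(2)[of y] y by simp
      show "alg_invertible (a - a\<^sup>2 * x - y *\<^sub>C 1)" using e1(2)[of y] y by simp
    qed
  qed
qed

text \<open>
  The idempotent \<open>1 - a * x\<close> does not qualify in general: it need not lie in the double
  commutant, and \<open>a\<close> may have the eigenvalue \<open>-1\<close> on its range.  The Riesz idempotent of a small disc
  with boundary in the resolvent set cures both defects: a radius below 1 keeps \<open>-1\<close> out of the
  spectrum of \<open>a * p\<close>.
\<close>

lemma ag_drazin_spectral_idempotent:
  fixes a :: "'a::complex_banach_algebra_1"
  assumes "is_ag_drazin_inverse a x"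
  obtains p where "p \<in> double_commutant {a}" "p * p = p"
    "alg_invertible (a + p)" "a * p \<in> acc_elems"
proof -
  \<comment> \<open>\<open>\<delta>\<close> is at most 1 and small enough for \<open>cmod z * norm x < 1\<close> to hold when \<open>cmod z < \<delta>\<close>.\<close>
  define \<delta> where "\<delta> = 1 / (norm x + 1)"
  have pos: "norm x + 1 > 0" by (simp add: add_nonneg_pos)
  have \<delta>: "0 < \<delta>" "\<delta> \<le> 1" using pos by (simp_all add: \<delta>_def field_simps)
  have near: "\<exists>e>0. \<forall>y. 0 < dist z y \<and> dist z y < e \<longrightarrow> alg_invertible (a - y *\<^sub>C 1)"
    if "z \<noteq> 0" "cmod z < \<delta>" for z
  proof (rule ag_drazin_isolated_near_zero[OF assms that(1)])
    have "cmod z * norm x \<le> cmod z * (norm x + 1)" by (simp add: mult_left_mono)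
    also have "\<dots> < 1" using that(2) pos by (simp add: \<delta>_def field_simps)
    finally show "cmod z * norm x < 1" .
  qed
  obtain r where r: "0 < r" "r < \<delta>" "\<And>z. cmod z = r \<Longrightarrow> alg_invertible (a - z *\<^sub>C 1)"
    by (rule circle_avoiding_discrete_set[OF \<delta>(1), of "{z. \<not> alg_invertible (a - z *\<^sub>C 1)}"])
       (use near in auto)
  obtain p v where pv: "p \<in> double_commutant {a}" "p * p = p"
    "\<And>z. cmod z \<ge> r \<Longrightarrow> alg_invertible (a * p - z *\<^sub>C 1)"
    "a * v = 1 - p" "v * a = 1 - p" "p * v = 0" "v * p = 0"
    using riesz_idempotent_disc[OF r(1,3)] by blast
  have ap: "a * p = p * a" using pv(1) by (rule double_commutant_commute)
  show thesis
  proof (rule that[OF pv(1,2)])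
    have inv: "alg_invertible (a * p + 1)"
      using pv(3)[of "-1"] r(2) \<delta>(2) by (simp add: scaleC_minus_left scaleC_one)
    define E where "E = alg_inverse (a * p + 1)"
    have app: "a * p * p = a * p" "p * (a * p) = a * p" "a * (p * p) = a * p"
      using ap pv(2) by (metis mult.assoc)+
    have Ep: "E * p = p * E" unfolding E_def
      using inv by (rule alg_inverse_commute) (simp add: algebra_simps app ap[symmetric])
    have up: "(a + p) * p = (a * p + 1) * p" "p * (a + p) = p * (a * p + 1)"
      by (simp_all add: distrib_left distrib_right app pv(2) flip: ap)
    show "alg_invertible (a + p)"
    proof (rule alg_invertible_split)
      have "(a + p) * (p * E) = (a * p + 1) * (p * E)" by (simp only: up flip: mult.assoc)
      also have "\<dots> = (a * p + 1) * (E * p)" by (simp only: Ep)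
      also have "\<dots> = p" unfolding E_def by (rule alg_inverse_cancel(1)[OF inv])
      finally show "(a + p) * (p * E) = p" .
      have "p * E * (a + p) = E * (p * (a + p))" by (simp only: Ep flip: mult.assoc)
      also have "\<dots> = p * (E * (a * p + 1))" by (simp only: up Ep flip: mult.assoc)
      finally show "p * E * (a + p) = p" unfolding E_def by (simp add: alg_inverse(2)[OF inv])
      show "(a + p) * v = 1 - p" "v * (a + p) = 1 - p"
        by (simp_all add: distrib_left distrib_right pv)
    qed
    show "a * p \<in> acc_elems"
      unfolding acc_elems_iff
    proof (intro allI impI)
      fix z :: complex assume z: "z \<noteq> 0"
      show "\<exists>e>0. \<forall>y. 0 < dist z y \<and> dist z y < e \<longrightarrow> alg_invertible (a * p - y *\<^sub>C 1)"
      proof (cases "cmod z < \<delta>")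
        case True
        then obtain e where e: "e > 0"
          "\<And>y. 0 < dist z y \<Longrightarrow> dist z y < e \<Longrightarrow> alg_invertible (a - y *\<^sub>C 1)"
          using near[OF z] by blast
        have "alg_invertible (a * p - y *\<^sub>C 1)" if "0 < dist z y" "dist z y < min e (cmod z)" for y
        proof (rule alg_invertible_compression_diff[OF pv(2) ap])
          show "y \<noteq> 0" using that by auto
          show "alg_invertible (a - y *\<^sub>C 1)" using that e by simp
        qed
        then show ?thesis using e z by (intro exI[of _ "min e (cmod z)"]) auto
      next
        case False
        have "cmod y \<ge> r" if "dist z y < \<delta> - r" for y
          using False that norm_triangle_ineq2[of z y] by (simp add: dist_norm)
        then show ?thesis using pv(3) r by (intro exI[of _ "\<delta> - r"]) auto
      qed
    qed
  qed
qed

text \<open>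
  The elements \<open>a\<close> and \<open>a + p\<close> agree on the corner of \<open>1 - p\<close>.  Hence \<open>b = (a + p)\<^sup>-\<^sup>1 * (1 - p)\<close>
  satisfies \<open>a * b = b * a = 1 - p\<close>, and \<open>a - a\<^sup>2 * b\<close> collapses to \<open>a * p\<close>.
\<close>

lemma ag_drazin_inverse_of_idempotent:
  fixes a p :: "'a::complex_banach_algebra_1"
  assumes ap: "a * p = p * a" and idem: "p * p = p"
    and inv: "alg_invertible (a + p)" and acc: "a * p \<in> acc_elems"
  shows "is_ag_drazin_inverse a (alg_inverse (a + p) * (1 - p))"
proof -
  define E where "E = alg_inverse (a + p)"
  define b where "b = E * (1 - p)"
  have Ea: "E * a = a * E" and Ep: "E * p = p * E"
    unfolding E_def using inv by (auto intro!: alg_inverse_commute simp: algebra_simps ap)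
  have "(a + p) * (1 - p) = a * (1 - p)" by (simp add: algebra_simps idem)
  moreover have "E * ((a + p) * (1 - p)) = 1 - p"
    unfolding E_def by (rule alg_inverse_cancel(2)[OF inv])
  ultimately have Ea1: "E * (a * (1 - p)) = 1 - p" by simp
  have a1: "a * (1 - p) = (1 - p) * a" by (simp add: algebra_simps ap)
  have ba: "b * a = 1 - p" using Ea1 by (simp add: b_def mult.assoc a1)
  have "a * b = E * a * (1 - p)" by (simp only: b_def Ea flip: mult.assoc)
  then have ab: "a * b = 1 - p" using Ea1 by (simp add: mult.assoc)
  have "p * b = E * (p * (1 - p))" by (simp only: b_def Ep flip: mult.assoc)
  then have "p * b = 0" by (simp add: right_diff_distrib idem)
  then have "b * a * b = b" by (simp add: ba left_diff_distrib)
  moreover have "a - a\<^sup>2 * b = a - a * (a * b)" by (simp add: power2_eq_square mult.assoc)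
  then have "a - a\<^sup>2 * b = a * p" by (simp add: ab right_diff_distrib)
  ultimately show ?thesis
    using acc ab ba unfolding is_ag_drazin_inverse_def b_def E_def by (simp add: commutant_def)
qed

theorem theorem5:
  fixes a :: "'a::complex_banach_algebra_1"
  shows
    "(a \<in> ag_drazin_invertibles \<longleftrightarrow>
        (\<exists>p \<in> double_commutant {a}.
           idempotent_elem p \<and> alg_invertible (a + p) \<and> a * p \<in> acc_elems)) \<and>
     (a \<in> ag_drazin_invertibles \<longleftrightarrow>
        (\<exists>p \<in> commutant {a}.
           idempotent_elem p \<and> alg_invertible (a + p) \<and> a * p \<in> acc_elems)) \<and>
     (\<forall>p \<in> double_commutant {a}.
        idempotent_elem p \<and> alg_invertible (a + p) \<and> a * p \<in> acc_elems \<longrightarrow>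
        is_ag_drazin_inverse a (alg_inverse (a + p) * (1 - p)))"
proof -
  let ?good = "\<lambda>p. idempotent_elem p \<and> alg_invertible (a + p) \<and> a * p \<in> acc_elems"
  have sub: "double_commutant {a} \<subseteq> commutant {a}"
    using double_commutant_commute[of _ a] by (auto simp: commutant_def)
  have construct: "is_ag_drazin_inverse a (alg_inverse (a + p) * (1 - p))"
    if "p \<in> commutant {a}" "?good p" for p
    using that ag_drazin_inverse_of_idempotent[of a p]
    by (simp add: commutant_def idempotent_elem_def)
  have spectral: "\<exists>p \<in> double_commutant {a}. ?good p" if "a \<in> ag_drazin_invertibles"
    using that ag_drazin_spectral_idempotent[of a]
    unfolding ag_drazin_invertibles_def idempotent_elem_def by blast
  have "(\<exists>p \<in> commutant {a}. ?good p) \<Longrightarrow> a \<in> ag_drazin_invertibles"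
    using construct unfolding ag_drazin_invertibles_def by blast
  then show ?thesis using sub construct spectral by blast
qed

end
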